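(* Let $1\le l\le n-2$ and $m=n-l$. Let $\mathcal L(T_{m,l})$ be the line graph of the tadpole $T_{m,l}$; explicitly, it is the graph on $n$ vertices consisting of a cycle $c_1c_2\cdots c_m$ (for $m=2$, a single edge $c_1c_2$), a path $p_1p_2\cdots p_l$, and the two extra edges $c_1p_1$ and $c_2p_1$. Then \[ X_{\mathcal L(T_{n-l,l})}=\sum_{\substack{I\vDash n\\ \Theta_I^+(l)=0}}\bigl(\Theta_I^+(l+1)-1\bigr)w_I\,e_I+2\sum_{\substack{I\vDash n\\ \Theta_I^+(l)\ge2}}\Theta_I^+(l+1)\,w_I\,e_I . \]
   Context: A composition $I=i_1\cdots i_s\vDash n$ is a sequence of positive integers with sum $n$; $e_I=e_{i_1}\cdots e_{i_s}$ (elementary symmetric functions); $w_I=i_1\prod_{j\ge2}(i_j-1)$. For $0\le a\le n$, $\sigma_I^+(a)=\min\{i_1+\dots+i_k:0\le k\le s,\ i_1+\dots+i_k\ge a\}$ and $\Theta_I^+(a)=\sigma_I^+(a)-a$. The tadpole $T_{m,l}$ is obtained by joining a vertex of the cycle $C_m$ to an end of the path $P_l$ by an edge. The chromatic symmetric function of a graph $G$ is $X_G=\sum_\kappa\prod_{v\in V(G)}x_{\kappa(v)}$ over proper colorings $\kappa:V(G)\to\{1,2,\dots\}$. *)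

theory Defs
  imports Complex_Main "HOL-Library.Multiset" "HOL-Library.FuncSet"
begin

section \<open>Formal power series in the variables \<open>x\<^sub>0, x\<^sub>1, x\<^sub>2, \<dots>\<close>\<close>

text \<open>
  A monomial is a finite multiset of variable indices, so that multiplication of monomials is
  addition of multisets; a series is its coefficient function. Multiplication is the Cauchy
  product, which is well defined since every monomial has only finitely many factorizations.
\<close>

typedef 'a mfps = "UNIV :: (nat multiset \<Rightarrow> 'a) set"
  morphisms mcoeff Mfps
  by simp

setup_lifting type_definition_mfps

lemma mfps_eqI: "(\<And>M. mcoeff f M = mcoeff g M) \<Longrightarrow> f = g"
  by (simp add: mcoeff_inject[symmetric] fun_eq_iff)

lemma finite_submultisets: "finite {A :: 'b multiset. A \<subseteq># M}"
proof (induction M)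
  case empty
  then show ?case by simp
next
  case (add x M)
  have "{A. A \<subseteq># add_mset x M} \<subseteq> {A. A \<subseteq># M} \<union> add_mset x ` {A. A \<subseteq># M}"
  proof
    fix A assume "A \<in> {A. A \<subseteq># add_mset x M}"
    then have A: "A \<subseteq># add_mset x M" by simp
    show "A \<in> {A. A \<subseteq># M} \<union> add_mset x ` {A. A \<subseteq># M}"
    proof (cases "x \<in># A")
      case True
      then obtain B where B: "A = add_mset x B" by (meson multi_member_split)
      with A have "B \<subseteq># M" by simp
      with B show ?thesis by blast
    next
      case False
      have "count A y \<le> count M y" for y
        using mset_subset_eq_count[OF A, of y] False by (cases "y = x") (auto simp: not_in_iff)
      then have "A \<subseteq># M" by (simp add: subseteq_mset_def)
      then show ?thesis by simp
    qed
  qed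
  then show ?case using add.IH by (meson finite_UnI finite_imageI finite_subset)
qed

lemma finite_factorizations: "finite {(A, B). A + B = (M :: 'b multiset)}"
proof -
  have "{(A, B). A + B = M} \<subseteq> {A. A \<subseteq># M} \<times> {A. A \<subseteq># M}"
    by auto
  then show ?thesis
    by (rule finite_subset) (intro finite_SigmaI finite_submultisets)
qed

instantiation mfps :: (comm_ring_1) comm_ring_1
begin

lift_definition zero_mfps :: "'a mfps" is "\<lambda>_. 0" .

lift_definition one_mfps :: "'a mfps" is "\<lambda>M. if M = {#} then 1 else 0" .

lift_definition plus_mfps :: "'a mfps \<Rightarrow> 'a mfps \<Rightarrow> 'a mfps" is "\<lambda>f g M. f M + g M" .

lift_definition minus_mfps :: "'a mfps \<Rightarrow> 'a mfps \<Rightarrow> 'a mfps" is "\<lambda>f g M. f M - g M" .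

lift_definition uminus_mfps :: "'a mfps \<Rightarrow> 'a mfps" is "\<lambda>f M. - f M" .

lift_definition times_mfps :: "'a mfps \<Rightarrow> 'a mfps \<Rightarrow> 'a mfps"
  is "\<lambda>f g M. \<Sum>(A, B) \<in> {(A, B). A + B = M}. f A * g B" .

instance
proof
  fix a b c :: "'a mfps"
  show "a * b * c = a * (b * c)"
  proof (rule mfps_eqI)
    fix M
    let ?a = "mcoeff a" and ?b = "mcoeff b" and ?c = "mcoeff c"
    let ?F = "\<lambda>M :: nat multiset. {(A, B). A + B = M}"
    have "mcoeff (a * b * c) M = (\<Sum>x\<in>?F M. \<Sum>y\<in>?F (fst x). ?a (fst y) * ?b (snd y) * ?c (snd x))"
      by (simp add: times_mfps.rep_eq sum_distrib_right case_prod_unfold)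
    also have "\<dots> = (\<Sum>(x, y)\<in>Sigma (?F M) (\<lambda>x. ?F (fst x)). ?a (fst y) * ?b (snd y) * ?c (snd x))"
      by (rule sum.Sigma) (auto intro: finite_factorizations)
    also have "\<dots> = (\<Sum>(x, y)\<in>Sigma (?F M) (\<lambda>x. ?F (snd x)). ?a (fst x) * (?b (fst y) * ?c (snd y)))"
      by (rule sum.reindex_bij_witness[where
            i = "\<lambda>(x, y). ((fst x + fst y, snd y), (fst x, fst y))" and
            j = "\<lambda>(x, y). ((fst y, snd y + snd x), (snd y, snd x))"])
        (auto simp: add.assoc mult.assoc)
    also have "\<dots> = (\<Sum>x\<in>?F M. \<Sum>y\<in>?F (snd x). ?a (fst x) * (?b (fst y) * ?c (snd y)))"
      by (rule sum.Sigma[symmetric]) (auto intro: finite_factorizations)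
    also have "\<dots> = mcoeff (a * (b * c)) M"
      by (simp add: times_mfps.rep_eq sum_distrib_left case_prod_unfold)
    finally show "mcoeff (a * b * c) M = mcoeff (a * (b * c)) M" .
  qed
  show "a * b = b * a"
  proof (rule mfps_eqI)
    fix M
    show "mcoeff (a * b) M = mcoeff (b * a) M"
      unfolding times_mfps.rep_eq
      by (rule sum.reindex_bij_witness[where i = prod.swap and j = prod.swap])
        (auto simp: add.commute mult.commute)
  qed
  show "1 * a = a"
  proof (rule mfps_eqI)
    fix M
    have "mcoeff (1 * a) M = (\<Sum>(A, B)\<in>{({#} :: nat multiset, M)}. (if A = {#} then 1 else 0) * mcoeff a B)"
      unfolding times_mfps.rep_eq one_mfps.rep_eq
      by (rule sum.mono_neutral_right) (auto intro: finite_factorizations split: if_splits)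
    then show "mcoeff (1 * a) M = mcoeff a M" by simp
  qed
  show "(a + b) * c = a * c + b * c"
    by (rule mfps_eqI)
      (simp add: times_mfps.rep_eq plus_mfps.rep_eq case_prod_unfold distrib_right sum.distrib)
  show "(0 :: 'a mfps) \<noteq> 1"
    by transfer (metis zero_neq_one)
qed (transfer; simp add: algebra_simps fun_eq_iff)+

end

text \<open>
  The formal sum of the monomials \<open>mon b\<close>, \<open>b \<in> B\<close>, for a possibly infinite family in which
  every monomial occurs finitely often.
\<close>

definition monomial_sum :: "('b \<Rightarrow> nat multiset) \<Rightarrow> 'b set \<Rightarrow> 'a::comm_ring_1 mfps" where
  "monomial_sum mon B = Mfps (\<lambda>M. of_nat (card {b \<in> B. mon b = M}))"


section \<open>Elementary symmetric functions\<close>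

text \<open>Only the variables with positive index, \<open>x\<^sub>1, x\<^sub>2, \<dots>\<close>, are used.\<close>

definition elem_sym :: "nat \<Rightarrow> 'a::comm_ring_1 mfps" where
  "elem_sym k = monomial_sum mset_set {S. S \<subseteq> {1..} \<and> finite S \<and> card S = k}"

definition elem_sym_list :: "nat list \<Rightarrow> 'a::comm_ring_1 mfps" where
  "elem_sym_list I = prod_list (map elem_sym I)"

lemma finite_elem_sym_fibre:
  "finite {S \<in> {S. S \<subseteq> {1..} \<and> finite S \<and> card S = k}. mset_set S = M}"
  by (rule finite_subset[of _ "{set_mset M}"]) auto


section \<open>Compositions\<close>

definition compositions :: "nat \<Rightarrow> nat list set" where
  "compositions n = {I. (\<forall>i\<in>set I. 1 \<le> i) \<and> sum_list I = n}"

lemma finite_compositions: "finite (compositions n)"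
proof -
  have "length I \<le> sum_list I" if "\<forall>i\<in>set I. 1 \<le> i" for I :: "nat list"
    using that by (induction I) auto
  then have "compositions n \<subseteq> {I. set I \<subseteq> {..n} \<and> length I \<le> n}"
    by (auto simp: compositions_def member_le_sum_list)
  then show ?thesis
    by (rule finite_subset) (simp add: finite_lists_length_le)
qed

definition comp_weight :: "nat list \<Rightarrow> int" where
  "comp_weight I = int (hd I) * (\<Prod>i\<leftarrow>tl I. int i - 1)"

definition sigma_plus :: "nat list \<Rightarrow> nat \<Rightarrow> nat" where
  "sigma_plus I a = Min {sum_list (take k I) | k. k \<le> length I \<and> a \<le> sum_list (take k I)}"

definition Theta_plus :: "nat list \<Rightarrow> nat \<Rightarrow> int" where
  "Theta_plus I a = int (sigma_plus I a) - int a"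


section \<open>Graphs\<close>

text \<open>A simple graph is a pair of a vertex set and a set of two-element edges.\<close>

type_synonym 'v graph = "'v set \<times> 'v set set"

definition proper_colorings :: "'v graph \<Rightarrow> ('v \<Rightarrow> nat) set" where
  "proper_colorings G =
    {\<kappa> \<in> fst G \<rightarrow>\<^sub>E {1..}. \<forall>u v. {u, v} \<in> snd G \<longrightarrow> \<kappa> u \<noteq> \<kappa> v}"

definition chromatic_sym :: "'v graph \<Rightarrow> 'a::comm_ring_1 mfps" where
  "chromatic_sym G = monomial_sum (\<lambda>\<kappa>. image_mset \<kappa> (mset_set (fst G))) (proper_colorings G)"

lemma finite_coloring_fibre:
  assumes "finite (fst G)"
  shows "finite {\<kappa> \<in> proper_colorings G. image_mset \<kappa> (mset_set (fst G)) = M}"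
proof (rule finite_subset)
  show "{\<kappa> \<in> proper_colorings G. image_mset \<kappa> (mset_set (fst G)) = M} \<subseteq> fst G \<rightarrow>\<^sub>E set_mset M"
    using assms by (auto simp: proper_colorings_def PiE_iff extensional_def)
  show "finite (fst G \<rightarrow>\<^sub>E set_mset M)"
    using assms by (intro finite_PiE) auto
qed

text \<open>
  Multigraphs are needed because the cycle \<open>C\<^sub>2\<close> consists of two parallel edges; \<open>mg_ends\<close> maps
  an edge to its set of endpoints.
\<close>

record ('v, 'e) multigraph =
  mg_verts :: "'v set"
  mg_edges :: "'e set"
  mg_ends :: "'e \<Rightarrow> 'v set"

definition line_graph :: "('v, 'e) multigraph \<Rightarrow> 'e graph" where
  "line_graph H = (mg_edges H,
    {{e, f} | e f. e \<in> mg_edges H \<and> f \<in> mg_edges H \<and> e \<noteq> f \<and> mg_ends H e \<inter> mg_ends H f \<noteq> {}})"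

text \<open>
  In the tadpole the cycle has the vertices \<open>Inl 1, \<dots>, Inl m\<close> and the path the vertices
  \<open>Inr 1, \<dots>, Inr l\<close>; the connecting edge joins \<open>Inl 1\<close> to \<open>Inr 1\<close>. Every edge carries the name of
  one of its endpoints: the edge \<open>Inl i\<close> joins the vertex \<open>Inl i\<close> to its cyclic predecessor, the
  edge \<open>Inr 1\<close> is the connecting edge, and \<open>Inr j\<close> joins \<open>Inr (j - 1)\<close> to \<open>Inr j\<close>.
\<close>

definition tadpole :: "nat \<Rightarrow> nat \<Rightarrow> (nat + nat, nat + nat) multigraph" where
  "tadpole m l =
    \<lparr>mg_verts = Inl ` {1..m} \<union> Inr ` {1..l},
     mg_edges = Inl ` {1..m} \<union> Inr ` {1..l},
     mg_ends = (\<lambda>e. case e of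
        Inl i \<Rightarrow> {Inl (if i = 1 then m else i - 1), Inl i}
      | Inr j \<Rightarrow> {if j = 1 then Inl 1 else Inr (j - 1), Inr j})\<rparr>"

text \<open>Explicit form, with \<open>c\<^sub>i = Inl i\<close> and \<open>p\<^sub>j = Inr j\<close>.\<close>

lemma line_graph_tadpole:
  assumes "2 \<le> m" and "1 \<le> l"
  shows "line_graph (tadpole m l) =
    (Inl ` {1..m} \<union> Inr ` {1..l},
     {{Inl i, Inl (i + 1)} | i. 1 \<le> i \<and> i < m} \<union> {{Inl m, Inl 1}} \<union>
     {{Inr j, Inr (j + 1)} | j. 1 \<le> j \<and> j < l} \<union>
     {{Inl 1, Inr 1}, {Inl 2, Inr 1}})"
    (is "_ = (?V, ?E)")
proof -
  let ?T = "tadpole m l"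
  have E: "mg_edges ?T = ?V"
    by (simp add: tadpole_def)
  have L: "mg_ends ?T (Inl i) = {Inl (if i = 1 then m else i - 1), Inl i}" for i
    by (simp add: tadpole_def)
  have R: "mg_ends ?T (Inr j) = {if j = 1 then Inl 1 else Inr (j - 1), Inr j}" for j
    by (simp add: tadpole_def)
  have LL: "{Inl i, Inl i'} \<in> ?E"
    if "i \<in> {1..m}" "i' \<in> {1..m}" "i \<noteq> i'" "mg_ends ?T (Inl i) \<inter> mg_ends ?T (Inl i') \<noteq> {}" for i i'
  proof -
    have "i' = i + 1 \<or> i = i' + 1 \<or> (i = m \<and> i' = 1) \<or> (i = 1 \<and> i' = m)"
      using that by (auto simp: L split: if_splits)
    then show ?thesis
    proof (elim disjE)
      assume "i' = i + 1"
      then have "{Inl i, Inl i'} = {Inl i, Inl (i + 1)} \<and> 1 \<le> i \<and> i < m"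
        using that by simp
      then show ?thesis by (intro UnI1 CollectI exI)
    next
      assume "i = i' + 1"
      then have "{Inl i, Inl i'} = {Inl i', Inl (i' + 1)} \<and> 1 \<le> i' \<and> i' < m"
        using that by auto
      then show ?thesis by (intro UnI1 CollectI exI)
    next
      assume "i = m \<and> i' = 1"
      then have "{Inl i, Inl i'} = {Inl m, Inl 1}" by simp
      then show ?thesis by (intro UnI1 UnI2[of _ "{{Inl m, Inl 1}}"]) (simp only: singleton_iff)
    next
      assume "i = 1 \<and> i' = m"
      then have "{Inl i, Inl i'} = {Inl m, Inl 1}" by auto
      then show ?thesis by (intro UnI1 UnI2[of _ "{{Inl m, Inl 1}}"]) (simp only: singleton_iff)
    qed
  qed
  have RR: "{Inr j, Inr j'} \<in> ?E"
    if "j \<in> {1..l}" "j' \<in> {1..l}" "j \<noteq> j'" "mg_ends ?T (Inr j) \<inter> mg_ends ?T (Inr j') \<noteq> {}" for j j'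
  proof -
    have "j' = j + 1 \<or> j = j' + 1"
      using that by (auto simp: R split: if_splits)
    then show ?thesis
    proof
      assume "j' = j + 1"
      then have "{Inr j, Inr j'} = {Inr j, Inr (j + 1)} \<and> 1 \<le> j \<and> j < l"
        using that by simp
      then show ?thesis by (intro UnI1[OF UnI2] CollectI exI)
    next
      assume "j = j' + 1"
      then have "{Inr j, Inr j'} = {Inr j', Inr (j' + 1)} \<and> 1 \<le> j' \<and> j' < l"
        using that by auto
      then show ?thesis by (intro UnI1[OF UnI2] CollectI exI)
    qed
  qed
  have LR: "{Inl i, Inr j} \<in> ?E"
    if "i \<in> {1..m}" "j \<in> {1..l}" "mg_ends ?T (Inl i) \<inter> mg_ends ?T (Inr j) \<noteq> {}" for i j
  proof -
    have "j = 1 \<and> (i = 1 \<or> i = 2)"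
      using that assms by (auto simp: L R split: if_splits)
    then have "{Inl i, Inr j} \<in> {{Inl 1, Inr 1}, {Inl 2, Inr 1}}" by auto
    then show ?thesis by (rule UnI2)
  qed
  have EF: "{e, f} \<in> ?E" if "e \<in> ?V" "f \<in> ?V" "e \<noteq> f" "mg_ends ?T e \<inter> mg_ends ?T f \<noteq> {}" for e f
  proof -
    from that(1,2) consider
        (1) i i' where "e = Inl i" "f = Inl i'" "i \<in> {1..m}" "i' \<in> {1..m}"
      | (2) i j where "e = Inl i" "f = Inr j" "i \<in> {1..m}" "j \<in> {1..l}"
      | (3) i j where "e = Inr j" "f = Inl i" "i \<in> {1..m}" "j \<in> {1..l}"
      | (4) j j' where "e = Inr j" "f = Inr j'" "j \<in> {1..l}" "j' \<in> {1..l}"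
      by blast
    then show ?thesis
    proof cases
      case 1
      have "i \<noteq> i'" using that(3) 1(1,2) by simp
      then show ?thesis
        unfolding 1(1,2) by (rule LL[OF 1(3,4) _ that(4)[unfolded 1(1,2)]])
    next
      case 2
      show ?thesis
        unfolding 2(1,2) by (rule LR[OF 2(3,4) that(4)[unfolded 2(1,2)]])
    next
      case 3
      have "mg_ends ?T (Inl i) \<inter> mg_ends ?T (Inr j) \<noteq> {}"
        using that(4) unfolding 3(1,2) by (simp only: Int_commute not_False_eq_True)
      then show ?thesis
        unfolding 3(1,2) insert_commute[of "Inr j"] by (rule LR[OF 3(3,4)])
    next
      case 4
      have "j \<noteq> j'" using that(3) 4(1,2) by simp
      then show ?thesis
        unfolding 4(1,2) by (rule RR[OF 4(3,4) _ that(4)[unfolded 4(1,2)]])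
    qed
  qed
  have "snd (line_graph ?T) \<subseteq> ?E"
  proof
    fix x assume "x \<in> snd (line_graph ?T)"
    then obtain e f where x: "x = {e, f}"
      and ef: "e \<in> ?V" "f \<in> ?V" "e \<noteq> f" "mg_ends ?T e \<inter> mg_ends ?T f \<noteq> {}"
      unfolding line_graph_def snd_conv E mem_Collect_eq by (elim exE conjE)
    show "x \<in> ?E"
      unfolding x by (rule EF[OF ef])
  qed
  moreover have "?E \<subseteq> snd (line_graph ?T)"
  proof -
    have mem: "{e, f} \<in> snd (line_graph ?T)"
      if "e \<in> ?V" "f \<in> ?V" "e \<noteq> f" "mg_ends ?T e \<inter> mg_ends ?T f \<noteq> {}" for e f
      unfolding line_graph_def snd_conv E mem_Collect_eq using that by (intro exI conjI) (rule refl)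
    have 1: "{Inl i, Inl (i + 1)} \<in> snd (line_graph ?T)" if "1 \<le> i" "i < m" for i
      using that by (intro mem) (auto simp: L)
    have 2: "{Inl m, Inl 1} \<in> snd (line_graph ?T)"
      using assms by (intro mem) (auto simp: L)
    have 3: "{Inr j, Inr (j + 1)} \<in> snd (line_graph ?T)" if "1 \<le> j" "j < l" for j
      using that by (intro mem) (auto simp: R)
    have 4: "{Inl 1, Inr 1} \<in> snd (line_graph ?T)"
      using assms by (intro mem) (auto simp: L R)
    have 5: "{Inl 2, Inr 1} \<in> snd (line_graph ?T)"
      using assms by (intro mem) (auto simp: L R)
    show ?thesis
    proof (intro Un_least)
      show "{{Inl i, Inl (i + 1)} | i. 1 \<le> i \<and> i < m} \<subseteq> snd (line_graph ?T)"
        using 1 by blast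
      show "{{Inr j, Inr (j + 1)} | j. 1 \<le> j \<and> j < l} \<subseteq> snd (line_graph ?T)"
        using 3 by blast
    qed (use 2 4 5 in \<open>simp_all only: insert_subset empty_subsetI simp_thms\<close>)
  qed
  ultimately have "snd (line_graph ?T) = ?E"
    by (rule subset_antisym)
  moreover have "fst (line_graph ?T) = ?V"
    by (simp only: line_graph_def fst_conv E)
  ultimately show ?thesis
    by (simp only: prod_eq_iff fst_conv snd_conv simp_thms)
qed

end

theory Submission
  imports Defs
begin

text \<open>
  Reading the colors along a Hamiltonian path turns the colorings of paths, cycles, tadpoles and
  line graphs of tadpoles into words without equal neighbours whose last letter differs from one
  or two prescribed letters. Write \<open>P\<^sub>n\<close>, \<open>C\<^sub>n\<close>, \<open>T\<^sub>n\<^sub>,\<^sub>l\<close> for the series of the path, the cycle and the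
  tadpole with \<open>n\<close> vertices, \<open>l\<close> of them on the tail. The two letters forbidden for the line graph
  are adjacent, hence different, so its series is \<open>T\<^sub>n\<^sub>,\<^sub>l + T\<^sub>n\<^sub>,\<^sub>l\<^sub>-\<^sub>1 - P\<^sub>n\<close>. Similarly
  \<open>T\<^sub>n\<^sub>,\<^sub>l = T\<^sub>n\<^sub>,\<^sub>l\<^sub>-\<^sub>1 + P\<^sub>l C\<^sub>n\<^sub>-\<^sub>l - P\<^sub>n\<close>, which together with \<open>T\<^sub>n\<^sub>,\<^sub>n\<^sub>-\<^sub>1 = 0\<close> determines all
  \<open>T\<^sub>n\<^sub>,\<^sub>l\<close>, including \<open>C\<^sub>n = T\<^sub>n\<^sub>,\<^sub>0\<close>, from the \<open>P\<^sub>n\<close>. The sums of \<open>\<Theta>\<^sub>I\<^sup>+(l + 1) w\<^sub>I e\<^sub>I\<close> satisfy the same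
  recurrence: \<open>\<Theta>\<^sub>I\<^sup>+\<close> decreases by one at each step except at a partial sum of \<open>I\<close>, where \<open>I\<close> splits
  into compositions of \<open>l\<close> and \<open>n - l\<close>. Finally \<open>P\<^sub>n = \<Sum>w\<^sub>I e\<^sub>I\<close> follows from
  \<open>P\<^sub>n = n e\<^sub>n + \<Sum>\<^sub>k\<^sub><\<^sub>n (k - 1) e\<^sub>k P\<^sub>n\<^sub>-\<^sub>k\<close>.
\<close>

section \<open>Formal sums of monomials\<close>

lemma mcoeff_monomial_sum:
  "mcoeff (monomial_sum mon B) M = of_nat (card {b \<in> B. mon b = M})"
  by (simp add: monomial_sum_def Mfps_inverse)

lemma monomial_sum_reindex:
  assumes "\<And>a. a \<in> A \<Longrightarrow> g (f a) = a" "\<And>a. a \<in> A \<Longrightarrow> f a \<in> B"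
    and "\<And>b. b \<in> B \<Longrightarrow> f (g b) = b" "\<And>b. b \<in> B \<Longrightarrow> g b \<in> A"
    and "\<And>a. a \<in> A \<Longrightarrow> mon' (f a) = mon a"
  shows "monomial_sum mon A = monomial_sum mon' B"
proof (rule mfps_eqI)
  fix M
  have "bij_betw f {a \<in> A. mon a = M} {b \<in> B. mon' b = M}"
    using assms by (intro bij_betwI[where g = g]) (auto, metis)
  then show "mcoeff (monomial_sum mon A) M = mcoeff (monomial_sum mon' B) M"
    by (simp add: mcoeff_monomial_sum bij_betw_same_card)
qed

lemma monomial_sum_image:
  "inj_on f A \<Longrightarrow> monomial_sum mon (f ` A) = monomial_sum (\<lambda>a. mon (f a)) A"
  by (rule monomial_sum_reindex[where f = "inv_into A f" and g = f])
    (simp_all add: f_inv_into_f inv_into_into)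

text \<open>\<open>monomial_sum\<close> counts fibres with \<open>card\<close>, which is 0 on
  infinite sets, so the rules for sums and products are stated under this finiteness.\<close>

definition finite_fibres :: "('b \<Rightarrow> nat multiset) \<Rightarrow> 'b set \<Rightarrow> bool" where
  "finite_fibres mon B \<longleftrightarrow> (\<forall>M. finite {b \<in> B. mon b = M})"

lemma finite_fibres_mset: "finite_fibres mset (B :: nat list set)"
proof -
  have "finite {b \<in> B. mset b = M}" for M
  proof (rule finite_subset)
    show "{b \<in> B. mset b = M} \<subseteq> {w. set w \<subseteq> set_mset M \<and> length w = size M}" by auto
  qed (simp add: finite_lists_length_eq)
  then show ?thesis by (simp add: finite_fibres_def)
qed

text \<open>If \<open>f a + g b = M\<close>, then both summands are among the finitely many
  submultisets of \<open>M\<close>.\<close>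

lemma finite_fibres_times:
  assumes "finite_fibres f A" "finite_fibres g B"
  shows "finite_fibres (\<lambda>(a, b). f a + g b) (A \<times> B)"
proof -
  have "finite {x \<in> A \<times> B. (case x of (a, b) \<Rightarrow> f a + g b) = M}" for M
  proof (rule finite_subset)
    show "{x \<in> A \<times> B. (case x of (a, b) \<Rightarrow> f a + g b) = M}
        \<subseteq> (\<Union>N \<in> {N. N \<subseteq># M}. {a \<in> A. f a = N}) \<times> (\<Union>N \<in> {N. N \<subseteq># M}. {b \<in> B. g b = N})"
      by auto
  qed (use assms in \<open>auto simp: finite_fibres_def finite_submultisets\<close>)
  then show ?thesis by (simp add: finite_fibres_def)
qed

lemma monomial_sum_split:
  assumes "finite_fibres mon B"
  shows "monomial_sum mon B = monomial_sum mon {b \<in> B. P b} + monomial_sum mon {b \<in> B. \<not> P b}"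
proof (rule mfps_eqI)
  fix M
  have fin: "finite {b \<in> B. mon b = M}"
    using assms by (simp add: finite_fibres_def)
  have "{b \<in> B. mon b = M} = {b \<in> {b \<in> B. P b}. mon b = M} \<union> {b \<in> {b \<in> B. \<not> P b}. mon b = M}"
    by auto
  moreover have "finite {b \<in> {b \<in> B. P b}. mon b = M}" "finite {b \<in> {b \<in> B. \<not> P b}. mon b = M}"
    by (rule finite_subset[OF _ fin]; auto)+
  ultimately have "card {b \<in> B. mon b = M} =
      card {b \<in> {b \<in> B. P b}. mon b = M} + card {b \<in> {b \<in> B. \<not> P b}. mon b = M}"
    by (simp only:) (rule card_Un_disjoint; auto)
  then show "mcoeff (monomial_sum mon B) M =
      mcoeff (monomial_sum mon {b \<in> B. P b} + monomial_sum mon {b \<in> B. \<not> P b}) M"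
    by (simp add: mcoeff_monomial_sum plus_mfps.rep_eq)
qed

lemma monomial_sum_empty: "monomial_sum mon {} = 0"
  by (rule mfps_eqI) (simp add: mcoeff_monomial_sum zero_mfps.rep_eq)

text \<open>Grouping the pairs with total monomial \<open>M\<close> by the factorization
  \<open>U + V = M\<close> they induce gives the Cauchy product.\<close>

lemma monomial_sum_times:
  assumes "finite_fibres f A" "finite_fibres g B"
  shows "monomial_sum f A * monomial_sum g B = monomial_sum (\<lambda>(a, b). f a + g b) (A \<times> B)"
proof (rule mfps_eqI)
  fix M :: "nat multiset"
  let ?F = "{(U, V). U + V = M}"
  have "card {x \<in> A \<times> B. (case x of (a, b) \<Rightarrow> f a + g b) = M}
      = card (\<Union>(U, V) \<in> ?F. {a \<in> A. f a = U} \<times> {b \<in> B. g b = V})"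
    by (rule arg_cong[where f = card]) auto
  also have "\<dots> = (\<Sum>(U, V) \<in> ?F. card {a \<in> A. f a = U} * card {b \<in> B. g b = V})"
    using assms finite_factorizations[of M] unfolding case_prod_unfold
    by (subst card_UN_disjoint) (auto simp: finite_fibres_def card_cartesian_product)
  finally show "mcoeff (monomial_sum f A * monomial_sum g B) M =
      mcoeff (monomial_sum (\<lambda>(a, b). f a + g b) (A \<times> B)) M"
    by (simp add: mcoeff_monomial_sum times_mfps.rep_eq case_prod_unfold)
qed

lemma mcoeff_of_nat_mult: "mcoeff (of_nat k * f) M = of_nat k * mcoeff f M"
  by (induction k) (auto simp: zero_mfps.rep_eq plus_mfps.rep_eq distrib_right)

text \<open>Marking one of \<open>k\<close> choices leaves the monomial unchanged. In this way an
  integer factor in front of a series becomes combinatorial.\<close>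

lemma monomial_sum_Sigma:
  assumes "finite_fibres mon B" and "\<And>b. b \<in> B \<Longrightarrow> finite (X b)" "\<And>b. b \<in> B \<Longrightarrow> card (X b) = k"
  shows "monomial_sum (\<lambda>(b, x). mon b) (Sigma B X) = of_nat k * monomial_sum mon B"
proof (rule mfps_eqI)
  fix M
  have "{p \<in> Sigma B X. (case p of (b, x) \<Rightarrow> mon b) = M} = Sigma {b \<in> B. mon b = M} X"
    by auto
  then have "card {p \<in> Sigma B X. (case p of (b, x) \<Rightarrow> mon b) = M} = card {b \<in> B. mon b = M} * k"
    using assms by (simp add: finite_fibres_def)
  then show "mcoeff (monomial_sum (\<lambda>(b, x). mon b) (Sigma B X)) M =
      mcoeff (of_nat k * monomial_sum mon B) M"
    by (simp add: mcoeff_monomial_sum mcoeff_of_nat_mult mult.commute)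
qed

lemma finite_fibres_Sigma:
  assumes "finite_fibres mon B" and "\<And>b. b \<in> B \<Longrightarrow> finite (X b)"
  shows "finite_fibres (\<lambda>(b, x). mon b) (Sigma B X)"
proof -
  have "{p \<in> Sigma B X. (case p of (b, x) \<Rightarrow> mon b) = M} = Sigma {b \<in> B. mon b = M} X" for M
    by auto
  then show ?thesis
    using assms by (auto simp: finite_fibres_def)
qed

section \<open>Words without equal neighbours\<close>

text \<open>These are the Carlitz words: proper colorings of a path, read along it. Thus
  \<open>path_sym n\<close> is the chromatic symmetric function of the path.\<close>

definition carlitz :: "nat \<Rightarrow> nat list set" where
  "carlitz n = {w. length w = n \<and> set w \<subseteq> {1..} \<and> distinct_adj w}"

abbreviation path_sym :: "nat \<Rightarrow> int mfps" where
  "path_sym n \<equiv> monomial_sum mset (carlitz n)"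

definition ksets :: "nat \<Rightarrow> nat set set" where
  "ksets k = {S. S \<subseteq> {1..} \<and> finite S \<and> card S = k}"

lemma finite_fibres_ksets: "finite_fibres mset_set (ksets k)"
  unfolding finite_fibres_def ksets_def using finite_elem_sym_fibre by blast

lemma carlitz_0: "carlitz 0 = {[]}"
  by (auto simp: carlitz_def)

lemma monomial_sum_singleton_empty: "mon b = {#} \<Longrightarrow> monomial_sum mon {b} = 1"
proof (rule mfps_eqI)
  fix M assume "mon b = {#}"
  then have "{x \<in> {b}. mon x = M} = (if M = {#} then {b} else {})" by auto
  then show "mcoeff (monomial_sum mon {b}) M = mcoeff 1 M"
    unfolding mcoeff_monomial_sum one_mfps.rep_eq by simp
qed

lemma path_sym_0: "path_sym 0 = 1"
  by (simp add: carlitz_0 monomial_sum_singleton_empty)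

lemma elem_sym_0: "elem_sym 0 = 1"
proof -
  have "{S :: nat set. S \<subseteq> {1..} \<and> finite S \<and> card S = 0} = {{}}" by auto
  then show ?thesis
    by (simp only: elem_sym_def monomial_sum_singleton_empty mset_set.empty)
qed

section \<open>Elementary functions times paths, and the path recurrence\<close>

definition set_word_mon :: "nat set \<times> nat list \<Rightarrow> nat multiset" where
  "set_word_mon = (\<lambda>(S, w). mset_set S + mset w)"

text \<open>These pairs measure the defect of moving a letter from the set to the front of the word:
  before the move they are the pairs with a letter that cannot move, after it the pairs that are
  never reached.\<close>

definition set_word_overlap :: "nat \<Rightarrow> nat \<Rightarrow> int mfps" where
  "set_word_overlap k j =
    monomial_sum set_word_mon {p \<in> ksets k \<times> carlitz j. snd p \<noteq> [] \<and> hd (snd p) \<in> fst p}"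

lemma finite_fibres_set_word: "finite_fibres set_word_mon (ksets k \<times> carlitz j)"
  unfolding set_word_mon_def by (intro finite_fibres_times finite_fibres_ksets finite_fibres_mset)

lemma elem_sym_times_path_sym:
  "elem_sym k * path_sym j = monomial_sum set_word_mon (ksets k \<times> carlitz j)"
  unfolding elem_sym_def set_word_mon_def ksets_def[symmetric]
  by (rule monomial_sum_times[OF finite_fibres_ksets finite_fibres_mset])

text \<open>
  Move a marked element of the set to the front of the word; this fails exactly when the word
  already starts with that element.
\<close>

lemma Suc_elem_sym_times_path_sym:
  "of_nat (Suc k) * (elem_sym (Suc k) * path_sym j) =
    set_word_overlap (Suc k) j - set_word_overlap k (Suc j) + elem_sym k * path_sym (Suc j)"
proof -
  let ?B = "ksets (Suc k) \<times> carlitz j" and ?mon = "\<lambda>(p, x :: nat). set_word_mon p"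
  let ?Q = "\<lambda>(p, x). snd p \<noteq> [] \<and> hd (snd p) = x"
  let ?C = "ksets k \<times> carlitz (Suc j)"
  have fin: "finite (fst p)" "card (fst p) = Suc k" if "p \<in> ?B" for p
    using that by (auto simp: ksets_def)
  have "of_nat (Suc k) * (elem_sym (Suc k) * path_sym j) = monomial_sum ?mon (Sigma ?B fst)"
    unfolding elem_sym_times_path_sym
    by (rule monomial_sum_Sigma[symmetric]) (use fin finite_fibres_set_word in auto)
  also have "\<dots> = monomial_sum ?mon {q \<in> Sigma ?B fst. ?Q q} + monomial_sum ?mon {q \<in> Sigma ?B fst. \<not> ?Q q}"
    by (rule monomial_sum_split, rule finite_fibres_Sigma) (use fin finite_fibres_set_word in auto)
  \<comment> \<open>The mark equals the head of the word, so it can be forgotten and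
    recovered.\<close>
  also have "monomial_sum ?mon {q \<in> Sigma ?B fst. ?Q q} = set_word_overlap (Suc k) j"
    unfolding set_word_overlap_def
    by (rule monomial_sum_reindex[where f = fst and g = "\<lambda>p. (p, hd (snd p))"]) auto
  \<comment> \<open>The moved letter has left the set, so the new head lies outside it; that head
    tells which letter to move back.\<close>
  also have "monomial_sum ?mon {q \<in> Sigma ?B fst. \<not> ?Q q} =
      monomial_sum set_word_mon {p \<in> ?C. \<not> (snd p \<noteq> [] \<and> hd (snd p) \<in> fst p)}"
  proof (rule monomial_sum_reindex[where f = "\<lambda>((S, w), x). (S - {x}, x # w)"
          and g = "\<lambda>(S, w). ((insert (hd w) S, tl w), hd w)"], goal_cases)
    case (1 q)
    then show ?case by (auto simp: insert_absorb)
  next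
    case (2 q)
    then show ?case by (auto simp: ksets_def carlitz_def distinct_adj_Cons)
  next
    case (3 p)
    then show ?case by (cases "snd p") (auto simp: ksets_def carlitz_def)
  next
    case (4 p)
    then show ?case by (cases "snd p") (auto simp: ksets_def carlitz_def distinct_adj_Cons)
  next
    case (5 q)
    then show ?case
      by (auto simp: set_word_mon_def ksets_def mset_set.remove)
  qed
  also have "\<dots> = elem_sym k * path_sym (Suc j) - set_word_overlap k (Suc j)"
    unfolding elem_sym_times_path_sym set_word_overlap_def
    by (subst monomial_sum_split[OF finite_fibres_set_word,
          where P = "\<lambda>p. snd p \<noteq> [] \<and> hd (snd p) \<in> fst p"]) simp
  finally show ?thesis by simp
qed

text \<open>These are the two ends of the telescoping sum in \<open>path_sym_rec\<close>.\<close>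

lemma set_word_overlap_0: "set_word_overlap 0 j = 0" "set_word_overlap k 0 = 0"
proof -
  have "{p \<in> ksets 0 \<times> carlitz j. snd p \<noteq> [] \<and> hd (snd p) \<in> fst p} = {}"
    "{p \<in> ksets k \<times> carlitz 0. snd p \<noteq> [] \<and> hd (snd p) \<in> fst p} = {}"
    by (auto simp: ksets_def carlitz_0)
  then show "set_word_overlap 0 j = 0" "set_word_overlap k 0 = 0"
    by (simp_all only: set_word_overlap_def monomial_sum_empty)
qed

text \<open>Summing \<open>Suc_elem_sym_times_path_sym\<close> over \<open>k < n\<close> with
  \<open>j = n - Suc k\<close> telescopes the overlaps away. What remains says that k e_k P_(n-k)
  summed over 1 <= k <= n equals e_k P_(n-k) summed over 0 <= k < n; solve for the term k = 0. In
  generating functions: P(z) = E(z) / (E(z) - z E'(z)).\<close>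

lemma path_sym_rec:
  assumes "1 \<le> n"
  shows "path_sym n = of_nat n * elem_sym n +
    (\<Sum>k = 1..<n. of_int (int k - 1) * (elem_sym k * path_sym (n - k)))"
proof -
  let ?r = "\<lambda>k. set_word_overlap k (n - k)" and ?p = "\<lambda>k. elem_sym k * path_sym (n - k)"
  have "(\<Sum>k<n. of_nat (Suc k) * ?p (Suc k)) = (\<Sum>k<n. ?r (Suc k) - ?r k) + (\<Sum>k<n. ?p k)"
    unfolding sum.distrib[symmetric]
  proof (rule sum.cong)
    fix k assume "k \<in> {..<n}"
    then have "n - k = Suc (n - Suc k)" by auto
    then show "of_nat (Suc k) * ?p (Suc k) = ?r (Suc k) - ?r k + ?p k"
      by (simp only: Suc_elem_sym_times_path_sym)
  qed simp
  also have "(\<Sum>k<n. ?r (Suc k) - ?r k) = 0"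
    by (subst sum_lessThan_telescope) (simp add: set_word_overlap_0)
  also have "(\<Sum>k<n. ?p k) = path_sym n + (\<Sum>k = 1..<n. ?p k)"
    using assms by (simp add: lessThan_atLeast0 sum.atLeast_Suc_lessThan elem_sym_0)
  also have "(\<Sum>k<n. of_nat (Suc k) * ?p (Suc k)) = (\<Sum>k = 1..<Suc n. of_nat k * ?p k)"
    using sum.shift_bounds_Suc_ivl[of "\<lambda>k. of_nat k * ?p k" 0 n] by (simp add: lessThan_atLeast0)
  also have "\<dots> = (\<Sum>k = 1..<n. of_nat k * ?p k) + of_nat n * elem_sym n"
    using assms by (simp add: path_sym_0)
  finally show ?thesis
    by (simp add: algebra_simps sum_subtractf)
qed

section \<open>Cycles and tadpoles as words\<close>

text \<open>
  The tadpole with a path of \<open>l\<close> vertices on \<open>n\<close> vertices, read from the free end of the path and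
  then once around the cycle; \<open>l = 0\<close> gives the cycle.
\<close>

definition tadpole_words :: "nat \<Rightarrow> nat \<Rightarrow> nat list set" where
  "tadpole_words n l = {w \<in> carlitz n. last w \<noteq> w ! l}"

abbreviation tadpole_sym :: "nat \<Rightarrow> nat \<Rightarrow> int mfps" where
  "tadpole_sym n l \<equiv> monomial_sum mset (tadpole_words n l)"

lemma path_sym_minus_tadpole_sym:
  "path_sym n - tadpole_sym n l = monomial_sum mset {w \<in> carlitz n. last w = w ! l}"
  unfolding tadpole_words_def
  by (subst monomial_sum_split[OF finite_fibres_mset, where P = "\<lambda>w. last w = w ! l"]) simp

text \<open>Position \<open>n - 1\<close> is the last letter itself, so the closing edge would be a
  loop. This anchors the downward induction on \<open>l\<close>.\<close>

lemma tadpole_sym_end: "1 \<le> n \<Longrightarrow> tadpole_sym n (n - 1) = 0"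
proof -
  assume "1 \<le> n"
  then have "tadpole_words n (n - 1) = {}"
    unfolding tadpole_words_def carlitz_def by (auto simp: last_conv_nth Suc_le_eq)
  then show ?thesis by (simp add: monomial_sum_empty)
qed

lemma distinct_adj_append_nonempty:
  "xs \<noteq> [] \<Longrightarrow> ys \<noteq> [] \<Longrightarrow>
    distinct_adj (xs @ ys) \<longleftrightarrow> distinct_adj xs \<and> distinct_adj ys \<and> last xs \<noteq> hd ys"
  by (auto simp: distinct_adj_append_iff)

text \<open>
  Concatenate a word and a cyclic word. If the letters at the seam agree, the cyclic word is first
  rotated by one step.
\<close>

lemma cycle_times_path:
  assumes "1 \<le> l" "l < n"
  shows "path_sym l * tadpole_sym (n - l) 0 = tadpole_sym n l + path_sym n - tadpole_sym n (l - 1)"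
proof -
  let ?B = "carlitz l \<times> tadpole_words (n - l) 0" and ?mon = "\<lambda>(a, b). mset a + mset b :: nat multiset"
  have a: "length a = l" "a \<noteq> []" "set a \<subseteq> {1..}" "distinct_adj a" if "a \<in> carlitz l" for a
    using that assms by (auto simp: carlitz_def)
  have b: "length b = n - l" "b \<noteq> []" "set b \<subseteq> {1..}" "distinct_adj b" "last b \<noteq> hd b"
    if "b \<in> tadpole_words (n - l) 0" for b
    using that assms by (cases b; auto simp: carlitz_def tadpole_words_def)+
  have bI: "b \<in> tadpole_words (n - l) 0"
    if "length b = n - l" "set b \<subseteq> {1..}" "distinct_adj b" "last b \<noteq> hd b" for b
    using that assms by (cases b) (auto simp: carlitz_def tadpole_words_def)
  have split: "\<exists>a b. w = a @ b \<and> length a = l \<and> a \<noteq> [] \<and> length b = n - l \<and> b \<noteq> [] \<and>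
      distinct_adj a \<and> distinct_adj b \<and> last a \<noteq> hd b \<and> set a \<subseteq> {1..} \<and> set b \<subseteq> {1..} \<and>
      w ! l = hd b \<and> w ! (l - 1) = last a \<and> last w = last b"
    if "w \<in> carlitz n" for w
  proof -
    have w: "length w = n" "set w \<subseteq> {1..}" "distinct_adj (take l w @ drop l w)"
      using that by (auto simp: carlitz_def)
    have ne: "take l w \<noteq> []" "drop l w \<noteq> []"
      using assms w by auto
    show ?thesis
      using w(2) w(3)[unfolded distinct_adj_append_nonempty[OF ne]] ne assms w(1) set_take_subset[of l w] set_drop_subset[of l w]
      by (intro exI[of _ "take l w"] exI[of _ "drop l w"]) (auto simp: hd_drop_conv_nth last_conv_nth)
  qed
  have "path_sym l * tadpole_sym (n - l) 0 = monomial_sum ?mon ?B"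
    by (intro monomial_sum_times finite_fibres_mset)
  also have "\<dots> = monomial_sum ?mon {p \<in> ?B. last (fst p) = hd (snd p)} +
      monomial_sum ?mon {p \<in> ?B. last (fst p) \<noteq> hd (snd p)}"
    by (intro monomial_sum_split finite_fibres_times finite_fibres_mset)
  also have "monomial_sum ?mon {p \<in> ?B. last (fst p) \<noteq> hd (snd p)} = tadpole_sym n l"
  proof (rule monomial_sum_reindex[where f = "\<lambda>(a, b). a @ b" and g = "\<lambda>w. (take l w, drop l w)"], goal_cases)
    case (1 p)
    then show ?case using a b by auto
  next
    case (2 p)
    then obtain p1 p2 where p: "p = (p1, p2)" "p1 \<in> carlitz l" "p2 \<in> tadpole_words (n - l) 0"
      "last p1 \<noteq> hd p2"
      by auto
    then show ?case using a[OF p(2)] b[OF p(3)] assms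
      by (simp add: tadpole_words_def carlitz_def distinct_adj_append_nonempty nth_append hd_conv_nth)
  next
    case (4 w)
    then have w: "w \<in> carlitz n" "last w \<noteq> w ! l"
      by (simp_all add: tadpole_words_def)
    from split[OF w(1)] w(2) show ?case
      by (elim exE conjE) (simp add: carlitz_def bI)
  qed auto
  \<comment> \<open>The rotated word has no equal neighbours: at the seam
    \<open>last a = hd b\<close> meets the second letter of \<open>b\<close>, and at the end
    \<open>last b\<close> meets \<open>hd b\<close>. Its last letter \<open>hd b = last a\<close>
    repeats position \<open>l - 1\<close>.\<close>
  also have "monomial_sum ?mon {p \<in> ?B. last (fst p) = hd (snd p)} =
      monomial_sum mset {w \<in> carlitz n. last w = w ! (l - 1)}"
  proof (rule monomial_sum_reindex[where f = "\<lambda>(a, b). a @ tl b @ [hd b]"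
          and g = "\<lambda>w. (take l w, last w # butlast (drop l w))"], goal_cases)
    case (1 p)
    then show ?case using a b by (auto simp: butlast_append)
  next
    case (2 p)
    then obtain p1 p2 where p: "p = (p1, p2)" "p1 \<in> carlitz l" "p2 \<in> tadpole_words (n - l) 0" "last p1 = hd p2"
      by auto
    obtain x c where c: "p2 = x # c" using b(2)[OF p(3)] by (cases p2) auto
    then have "c \<noteq> []" using b(5)[OF p(3)] by auto
    moreover have "p1 ! (l - 1) = last p1"
      using a[OF p(2)] by (simp add: last_conv_nth)
    ultimately show ?case using a[OF p(2)] b[OF p(3)] p(4) assms unfolding p(1) c
      by (simp add: carlitz_def distinct_adj_append_nonempty distinct_adj_Cons nth_append)
  next
    case (3 w)
    then have "w \<in> carlitz n" by simp
    from split[OF this] show ?case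
      by (elim exE conjE) simp
  next
    case (4 w)
    then have "w \<in> carlitz n" and l: "last w = w ! (l - 1)" by simp_all
    from split[OF this(1)] l obtain a b
      where w: "w = a @ b" "length a = l" "a \<noteq> []" "length b = n - l" "b \<noteq> []"
      "distinct_adj a" "distinct_adj b" "last a \<noteq> hd b" "set a \<subseteq> {1..}" "set b \<subseteq> {1..}"
      "last a = last b" "last w = last b"
      by (elim exE conjE) simp
    obtain c x where c: "b = c @ [x]" using w(5) by (metis append_butlast_last_id)
    \<comment> \<open>If \<open>b\<close> had one letter, \<open>last a = last b\<close> would
      contradict \<open>last a \<noteq> hd b\<close>.\<close>
    then have "c \<noteq> []" using w by auto
    then show ?case using w c assms bI[of "x # c"]
      by (simp add: carlitz_def distinct_adj_append_nonempty distinct_adj_Cons)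
  next
    case (5 p)
    then obtain p1 x c where "p = (p1, x # c)"
      using b(2) by (cases p; cases "snd p") auto
    then show ?case by simp
  qed
  also have "\<dots> = path_sym n - tadpole_sym n (l - 1)"
    by (rule path_sym_minus_tadpole_sym[symmetric])
  finally show ?thesis by simp
qed

section \<open>Sums over compositions\<close>

lemma elem_sym_list_append: "elem_sym_list (I @ J) = elem_sym_list I * elem_sym_list J"
  by (simp add: elem_sym_list_def)

lemma comp_weight_append: "I \<noteq> [] \<Longrightarrow> comp_weight (I @ J) = comp_weight I * (\<Prod>i\<leftarrow>J. int i - 1)"
  by (simp add: comp_weight_def)

lemma compositions_nonempty: "I \<in> compositions n \<Longrightarrow> 1 \<le> n \<Longrightarrow> I \<noteq> []"
  by (auto simp: compositions_def)

text \<open>The last part is split off because the weight singles out the first one: appending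
  \<open>k\<close> to a nonempty composition multiplies the weight by \<open>k - 1\<close>, and only
  \<open>[n]\<close> has to be treated separately.\<close>

lemma compositions_snoc:
  assumes "1 \<le> n"
  shows "compositions n = insert [n] (\<Union>k\<in>{1..<n}. (\<lambda>J. J @ [k]) ` compositions (n - k))"
proof (intro equalityI subsetI)
  fix I assume I: "I \<in> compositions n"
  then have "I \<noteq> []" using assms by (rule compositions_nonempty)
  then obtain J k where Jk: "I = J @ [k]" by (metis append_butlast_last_id)
  have J: "J \<in> compositions (n - k)" "1 \<le> k" "n = sum_list J + k"
    using I Jk by (auto simp: compositions_def)
  show "I \<in> insert [n] (\<Union>k\<in>{1..<n}. (\<lambda>J. J @ [k]) ` compositions (n - k))"
  proof (cases "J = []")
    case True
    then show ?thesis using J Jk by simp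
  next
    case False
    then have "k \<in> {1..<n}"
      using J(2,3) I Jk by (cases J) (auto simp: compositions_def)
    then show ?thesis using J(1) Jk by blast
  qed
qed (use assms in \<open>auto simp: compositions_def\<close>)

definition path_exp :: "nat \<Rightarrow> int mfps" where
  "path_exp n = (\<Sum>I\<in>compositions n. of_int (comp_weight I) * elem_sym_list I)"

lemma path_exp_rec:
  assumes "1 \<le> n"
  shows "path_exp n = of_nat n * elem_sym n +
    (\<Sum>k = 1..<n. of_int (int k - 1) * (elem_sym k * path_exp (n - k)))"
proof -
  let ?f = "\<lambda>I. of_int (comp_weight I) * elem_sym_list I :: int mfps"
  let ?A = "\<lambda>k. (\<lambda>J. J @ [k]) ` compositions (n - k)"
  have "path_exp n = ?f [n] + sum ?f (\<Union>k\<in>{1..<n}. ?A k)"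
    unfolding path_exp_def compositions_snoc[OF assms]
    by (rule sum.insert) (simp_all add: finite_compositions, auto simp: compositions_def)
  also have "sum ?f (\<Union>k\<in>{1..<n}. ?A k) = (\<Sum>k = 1..<n. sum ?f (?A k))"
    by (rule sum.UNION_disjoint) (auto simp: finite_compositions)
  also have "\<dots> = (\<Sum>k = 1..<n. of_int (int k - 1) * (elem_sym k * path_exp (n - k)))"
  proof (rule sum.cong)
    fix k assume k: "k \<in> {1..<n}"
    have "sum ?f (?A k) = (\<Sum>J\<in>compositions (n - k). ?f (J @ [k]))"
      by (subst sum.reindex) (auto simp: inj_on_def)
    also have "\<dots> = (\<Sum>J\<in>compositions (n - k). of_int (int k - 1) * (elem_sym k * ?f J))"
    proof (rule sum.cong)
      fix J assume "J \<in> compositions (n - k)"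
      \<comment> \<open>The weight of \<open>[]\<close> involves the unspecified
        \<open>hd []\<close>; here \<open>n - k\<close> is positive.\<close>
      then have "J \<noteq> []" using k by (intro compositions_nonempty) auto
      then show "?f (J @ [k]) = of_int (int k - 1) * (elem_sym k * ?f J)"
        by (simp add: comp_weight_append elem_sym_list_append) (simp add: elem_sym_list_def algebra_simps)
    qed simp
    finally show "sum ?f (?A k) = of_int (int k - 1) * (elem_sym k * path_exp (n - k))"
      by (simp add: path_exp_def sum_distrib_left)
  qed simp
  also have "?f [n] = of_nat n * elem_sym n"
    by (simp add: comp_weight_def elem_sym_list_def)
  finally show ?thesis .
qed

lemma path_sym_eq_path_exp: "1 \<le> n \<Longrightarrow> path_sym n = path_exp n"
proof (induction n rule: less_induct)
  case (less n)
  have "(\<Sum>k = 1..<n. of_int (int k - 1) * (elem_sym k * path_sym (n - k))) =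
      (\<Sum>k = 1..<n. of_int (int k - 1) * (elem_sym k * path_exp (n - k)))"
    by (rule sum.cong) (use less.IH in auto)
  then show ?case
    by (simp only: path_sym_rec[OF less.prems] path_exp_rec[OF less.prems])
qed

section \<open>Partial sums and the statistic \<open>Theta_plus\<close>\<close>

definition partial_sums :: "nat list \<Rightarrow> nat set" where
  "partial_sums I = {sum_list (take k I) | k. k \<le> length I}"

text \<open>The description by prefixes supplies the two pieces when a composition is cut at a
  partial sum.\<close>

lemma partial_sums_append: "partial_sums I = {sum_list J | J. \<exists>K. I = J @ K}"
  unfolding partial_sums_def
proof (intro equalityI subsetI)
  fix x assume "x \<in> {sum_list (take k I) | k. k \<le> length I}"
  then show "x \<in> {sum_list J | J. \<exists>K. I = J @ K}"
    using append_take_drop_id[of _ I, symmetric] by blast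
next
  fix x assume "x \<in> {sum_list J | J. \<exists>K. I = J @ K}"
  then obtain J K where "x = sum_list J" "I = J @ K" by blast
  then have "x = sum_list (take (length J) I)" "length J \<le> length I" by auto
  then show "x \<in> {sum_list (take k I) | k. k \<le> length I}" by blast
qed

lemma finite_partial_sums: "finite (partial_sums I)"
  unfolding partial_sums_def by simp

lemma sigma_plus_partial_sums: "sigma_plus I a = Min {x \<in> partial_sums I. a \<le> x}"
  unfolding sigma_plus_def partial_sums_def by (rule arg_cong[where f = Min]) auto

lemma sum_list_in_partial_sums: "sum_list I \<in> partial_sums I"
  unfolding partial_sums_def by force

text \<open>The total \<open>sum_list I\<close> is a candidate, so \<open>Min\<close> is taken over
  a nonempty set; beyond the total its value is unspecified.\<close>

lemma sigma_plus_mem: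
  assumes "a \<le> sum_list I"
  shows "sigma_plus I a \<in> partial_sums I" "a \<le> sigma_plus I a"
proof -
  have "Min {x \<in> partial_sums I. a \<le> x} \<in> {x \<in> partial_sums I. a \<le> x}"
    by (rule Min_in) (use assms finite_partial_sums sum_list_in_partial_sums in auto)
  then show "sigma_plus I a \<in> partial_sums I" "a \<le> sigma_plus I a"
    by (auto simp: sigma_plus_partial_sums)
qed

lemma Theta_plus_eq_0_iff:
  assumes "a \<le> sum_list I"
  shows "Theta_plus I a = 0 \<longleftrightarrow> a \<in> partial_sums I"
proof
  assume "Theta_plus I a = 0"
  then show "a \<in> partial_sums I"
    using sigma_plus_mem(1)[OF assms] by (simp add: Theta_plus_def)
next
  assume "a \<in> partial_sums I"
  then have "sigma_plus I a = a"
    unfolding sigma_plus_partial_sums by (intro Min_eqI) (auto simp: finite_partial_sums)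
  then show "Theta_plus I a = 0" by (simp add: Theta_plus_def)
qed

lemma Theta_plus_nonneg: "a \<le> sum_list I \<Longrightarrow> 0 \<le> Theta_plus I a"
  using sigma_plus_mem(2) by (simp add: Theta_plus_def)

text \<open>When \<open>a\<close> is not a partial sum, the next partial sum is the same seen from
  \<open>a\<close> and from \<open>a + 1\<close>.\<close>

lemma Theta_plus_Suc:
  assumes "a \<le> sum_list I" "Theta_plus I a \<noteq> 0"
  shows "Theta_plus I (a + 1) = Theta_plus I a - 1"
proof -
  have "{x \<in> partial_sums I. a \<le> x} = {x \<in> partial_sums I. a + 1 \<le> x}"
    using assms Theta_plus_eq_0_iff[OF assms(1)] by (metis (lifting) Suc_eq_plus1 Suc_le_eq le_less)
  then show ?thesis
    by (simp add: Theta_plus_def sigma_plus_partial_sums)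
qed

lemma Theta_plus_append:
  assumes "1 \<le> k"
  shows "Theta_plus (J @ k # K) (sum_list J + 1) = int k - 1"
proof -
  have "sigma_plus (J @ k # K) (sum_list J + 1) = sum_list J + k"
    unfolding sigma_plus_partial_sums
  proof (rule Min_eqI)
    fix y assume "y \<in> {x \<in> partial_sums (J @ k # K). sum_list J + 1 \<le> x}"
    then obtain i where i: "y = sum_list (take i (J @ k # K))" "sum_list J + 1 \<le> y"
      by (auto simp: partial_sums_def)
    \<comment> \<open>A prefix contained in \<open>J\<close> has sum at most
      \<open>sum_list J\<close>.\<close>
    have "length J < i"
    proof (rule ccontr)
      assume "\<not> length J < i"
      then have "y = sum_list (take i J)" using i by simp
      also have "\<dots> \<le> sum_list (take i J) + sum_list (drop i J)" by simp
      also have "\<dots> = sum_list J" by (metis append_take_drop_id sum_list_append)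
      finally show False using i by simp
    qed
    then obtain d where "i - length J = Suc d" by (metis Suc_diff_Suc)
    then show "sum_list J + k \<le> y" using i by simp
  next
    have "J @ k # K = (J @ [k]) @ K" "sum_list J + k = sum_list (J @ [k])" by auto
    then have "sum_list J + k \<in> partial_sums (J @ k # K)"
      unfolding partial_sums_append by blast
    then show "sum_list J + k \<in> {x \<in> partial_sums (J @ k # K). sum_list J + 1 \<le> x}"
      using assms by simp
  qed (simp add: finite_partial_sums)
  then show ?thesis by (simp add: Theta_plus_def)
qed

section \<open>Expansions of cycles and tadpoles\<close>

definition tadpole_exp :: "nat \<Rightarrow> nat \<Rightarrow> int mfps" where
  "tadpole_exp n l =
    (\<Sum>I\<in>compositions n. of_int (Theta_plus I (l + 1) * comp_weight I) * elem_sym_list I)"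

lemma tadpole_exp_end: "1 \<le> n \<Longrightarrow> tadpole_exp n (n - 1) = 0"
proof -
  assume n: "1 \<le> n"
  have "Theta_plus I n = 0" if "I \<in> compositions n" for I
    using that Theta_plus_eq_0_iff[of n I] sum_list_in_partial_sums[of I]
    by (simp add: compositions_def)
  then show ?thesis using n by (simp add: tadpole_exp_def)
qed

text \<open>The first positive partial sum is the first part, which gives the known expansion of the
  cycle.\<close>

lemma tadpole_exp_0:
  assumes "1 \<le> n"
  shows "tadpole_exp n 0 =
    (\<Sum>I\<in>compositions n. of_int ((int (hd I) - 1) * comp_weight I) * elem_sym_list I)"
  unfolding tadpole_exp_def
proof (rule sum.cong)
  fix I assume I: "I \<in> compositions n"
  then obtain k K where kK: "I = k # K"
    using compositions_nonempty[OF I assms] by (cases I) auto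
  then have "1 \<le> k" using I by (simp add: compositions_def)
  then have "Theta_plus I (0 + 1) = int (hd I) - 1"
    using Theta_plus_append[of k "[]" K] kK by simp
  then show "of_int (Theta_plus I (0 + 1) * comp_weight I) * elem_sym_list I =
      (of_int ((int (hd I) - 1) * comp_weight I) * elem_sym_list I :: int mfps)"
    by simp
qed simp

lemma compositions_break:
  assumes "l \<le> n"
  shows "{I \<in> compositions n. Theta_plus I l = 0} =
    (\<lambda>(J, K). J @ K) ` (compositions l \<times> compositions (n - l))"
proof -
  have "I \<in> compositions n \<and> Theta_plus I l = 0 \<longleftrightarrow>
      (\<exists>J K. I = J @ K \<and> J \<in> compositions l \<and> K \<in> compositions (n - l))" for I
  proof
    assume I: "I \<in> compositions n \<and> Theta_plus I l = 0"
    then have "l \<in> partial_sums I"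
      using Theta_plus_eq_0_iff[of l I] assms by (auto simp: compositions_def)
    then obtain J K where "I = J @ K" "sum_list J = l"
      by (auto simp: partial_sums_append)
    then show "\<exists>J K. I = J @ K \<and> J \<in> compositions l \<and> K \<in> compositions (n - l)"
      using I by (intro exI[of _ J] exI[of _ K]) (auto simp: compositions_def)
  next
    assume "\<exists>J K. I = J @ K \<and> J \<in> compositions l \<and> K \<in> compositions (n - l)"
    then obtain J K where JK: "I = J @ K" "J \<in> compositions l" "K \<in> compositions (n - l)"
      by blast
    then have I: "I \<in> compositions n" "sum_list I = n" "sum_list J = l"
      using assms by (auto simp: compositions_def)
    then have "l \<in> partial_sums I"
      using JK(1) unfolding partial_sums_append by blast
    then show "I \<in> compositions n \<and> Theta_plus I l = 0"
      using I Theta_plus_eq_0_iff[of l I] assms by simp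
  qed
  then show ?thesis by auto
qed

text \<open>Of two prefixes of one list, the longer extends the shorter; if their sums agree, the
  extension has sum 0 and is empty because parts are positive.\<close>

lemma inj_on_append_compositions:
  "inj_on (\<lambda>(J, K). J @ K) (compositions l \<times> compositions m)"
proof -
  have nil: "us = []" if "sum_list (us :: nat list) = 0" "\<forall>i\<in>set us. 1 \<le> i" for us
    using that by (cases us) auto
  have unique: "J = J' \<and> K = K'"
    if eq: "J @ K = J' @ K'" and J: "J \<in> compositions l" "J' \<in> compositions l" for J J' K K'
  proof -
    obtain us where us: "J = J' @ us \<and> us @ K = K' \<or> J @ us = J' \<and> K = us @ K'"
      using eq unfolding append_eq_append_conv2 by blast
    have c: "sum_list J = l" "sum_list J' = l" "\<forall>i\<in>set J. 1 \<le> i" "\<forall>i\<in>set J'. 1 \<le> i"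
      using J by (simp_all add: compositions_def)
    from us have "us = []"
    proof (elim disjE conjE)
      assume "J = J' @ us"
      then show ?thesis using c(1-3) by (intro nil) simp_all
    next
      assume "J @ us = J'"
      then have "J' = J @ us" by simp
      then show ?thesis using c(1,2,4) by (intro nil) simp_all
    qed
    then show ?thesis using us by auto
  qed
  show ?thesis
  proof (rule inj_onI)
    fix p q
    assume "p \<in> compositions l \<times> compositions m" "q \<in> compositions l \<times> compositions m"
      and "(case p of (J, K) \<Rightarrow> J @ K) = (case q of (J, K) \<Rightarrow> J @ K)"
    then have "fst p = fst q \<and> snd p = snd q"
      by (intro unique) (simp_all add: case_prod_unfold mem_Times_iff)
    then show "p = q" by (simp add: prod_eq_iff)
  qed
qed

text \<open>The coefficient \<open>?c\<close> vanishes by \<open>Theta_plus_Suc\<close> unless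
  \<open>l\<close> is a partial sum. If it is, then \<open>I = J @ K\<close> and \<open>?c\<close>
  equals \<open>hd K\<close>, exactly the factor by which the product of the weights of
  \<open>J\<close> and \<open>K\<close> differs from the weight of \<open>J @ K\<close>, up to the
  cycle factor \<open>hd K - 1\<close>.\<close>

lemma cycle_exp_times_path_exp:
  assumes "1 \<le> l" "l < n"
  shows "path_exp l * tadpole_exp (n - l) 0 = tadpole_exp n l + path_exp n - tadpole_exp n (l - 1)"
proof -
  let ?c = "\<lambda>I. Theta_plus I (l + 1) + 1 - Theta_plus I l"
  let ?f = "\<lambda>I. of_int (?c I * comp_weight I) * elem_sym_list I :: int mfps"
  have "tadpole_exp n l + path_exp n - tadpole_exp n (l - 1) = (\<Sum>I\<in>compositions n. ?f I)"
    using assms unfolding tadpole_exp_def path_exp_def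
    by (simp add: sum.distrib[symmetric] sum_subtractf[symmetric] algebra_simps)
  also have "\<dots> = (\<Sum>I \<in> {I \<in> compositions n. Theta_plus I l = 0}. ?f I)"
  proof (rule sum.mono_neutral_right)
    show "\<forall>I \<in> compositions n - {I \<in> compositions n. Theta_plus I l = 0}. ?f I = 0"
    proof
      fix I assume "I \<in> compositions n - {I \<in> compositions n. Theta_plus I l = 0}"
      then have "?c I = 0"
        using assms by (subst Theta_plus_Suc) (auto simp: compositions_def)
      then show "?f I = 0" by (simp only: mult_zero_left of_int_0)
    qed
  qed (auto simp: finite_compositions)
  also have "\<dots> = (\<Sum>(J, K) \<in> compositions l \<times> compositions (n - l). ?f (J @ K))"
    unfolding compositions_break[OF less_imp_le[OF assms(2)]]
    by (subst sum.reindex[OF inj_on_append_compositions]) (simp add: case_prod_unfold comp_def)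
  also have "\<dots> = (\<Sum>(J, K) \<in> compositions l \<times> compositions (n - l).
      (of_int (comp_weight J) * elem_sym_list J) *
      (of_int ((int (hd K) - 1) * comp_weight K) * elem_sym_list K))"
  proof (rule sum.cong, simp, clarify)
    fix J K assume JK: "J \<in> compositions l" "K \<in> compositions (n - l)"
    then have "J \<noteq> []" "K \<noteq> []"
      using assms by (auto dest!: compositions_nonempty)
    then obtain k K' where K: "K = k # K'" by (cases K) auto
    have "1 \<le> k" and J: "sum_list J = l"
      using JK K assms by (auto simp: compositions_def)
    then have "Theta_plus (J @ K) (l + 1) = int k - 1"
      using Theta_plus_append[of k J K'] K by simp
    moreover have "Theta_plus (J @ K) l = 0"
      using compositions_break[of l n] assms JK by force
    \<comment> \<open>Inside \<open>J @ K\<close> the first part of \<open>K\<close> contributes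
      \<open>k - 1\<close> instead of \<open>k\<close>.\<close>
    moreover have "comp_weight (J @ K) = comp_weight J * ((int k - 1) * (\<Prod>i\<leftarrow>K'. int i - 1))"
      using \<open>J \<noteq> []\<close> by (simp add: comp_weight_append K)
    ultimately have "?c (J @ K) * comp_weight (J @ K) =
        comp_weight J * ((int (hd K) - 1) * comp_weight K)"
      by (simp add: K comp_weight_def)
    then show "?f (J @ K) = (of_int (comp_weight J) * elem_sym_list J) *
        (of_int ((int (hd K) - 1) * comp_weight K) * elem_sym_list K)"
      by (simp only: of_int_mult elem_sym_list_append mult.assoc mult.left_commute)
  qed
  also have "\<dots> = path_exp l * tadpole_exp (n - l) 0"
    using assms by (simp add: path_exp_def tadpole_exp_0 sum_product sum.cartesian_product)
  finally show ?thesis ..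
qed

text \<open>For fixed \<open>n\<close> the recurrence is run downwards from
  \<open>l = n - 1\<close>; the cycle it involves has fewer than \<open>n\<close> vertices and is
  covered by the outer induction.\<close>

lemma tadpole_sym_eq_tadpole_exp: "l < n \<Longrightarrow> tadpole_sym n l = tadpole_exp n l"
proof (induction n arbitrary: l rule: less_induct)
  case (less n)
  then have n: "1 \<le> n" by simp
  have "l \<le> n - 1" using less.prems by simp
  then show ?case
  proof (induction l rule: inc_induct)
    case base
    show ?case using n by (simp only: tadpole_sym_end tadpole_exp_end)
  next
    case (step l)
    then have l: "1 \<le> Suc l" "Suc l < n" by auto
    have "tadpole_sym (n - Suc l) 0 = tadpole_exp (n - Suc l) 0"
      using l by (intro less.IH) auto
    then show ?case
      using cycle_times_path[OF l] cycle_exp_times_path_exp[OF l] step.IH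
        path_sym_eq_path_exp[OF l(1)] path_sym_eq_path_exp[OF n]
      by simp
  qed
qed

section \<open>The line graph of a tadpole\<close>

lemma distinct_adj_map_upt:
  "distinct_adj (map f [a..<b]) \<longleftrightarrow> (\<forall>i. a \<le> i \<and> Suc i < b \<longrightarrow> f i \<noteq> f (Suc i))"
proof -
  have "distinct_adj (map f [a..<b]) \<longleftrightarrow> (\<forall>i. Suc i < b - a \<longrightarrow> f (a + i) \<noteq> f (Suc (a + i)))"
    by (auto simp: distinct_adj_conv_nth)
  also have "\<dots> \<longleftrightarrow> (\<forall>i. a \<le> i \<and> Suc i < b \<longrightarrow> f i \<noteq> f (Suc i))"
  proof (intro iffI allI impI)
    fix i assume *: "\<forall>i. Suc i < b - a \<longrightarrow> f (a + i) \<noteq> f (Suc (a + i))" and i: "a \<le> i \<and> Suc i < b"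
    then have "Suc (i - a) < b - a" "a + (i - a) = i" by auto
    then show "f i \<noteq> f (Suc i)" using *[rule_format, of "i - a"] by simp
  qed auto
  finally show ?thesis .
qed

text \<open>Isolating the edge condition lets it be evaluated piece by piece along the explicit edge
  set of the line graph.\<close>

definition proper_on :: "('v \<Rightarrow> nat) \<Rightarrow> 'v set set \<Rightarrow> bool" where
  "proper_on \<kappa> E \<longleftrightarrow> (\<forall>u v. {u, v} \<in> E \<longrightarrow> \<kappa> u \<noteq> \<kappa> v)"

lemma proper_on_empty: "proper_on \<kappa> {} \<longleftrightarrow> True"
  by (simp add: proper_on_def)

lemma proper_on_Un: "proper_on \<kappa> (E \<union> F) \<longleftrightarrow> proper_on \<kappa> E \<and> proper_on \<kappa> F"
  by (auto simp: proper_on_def)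

lemma proper_on_insert: "proper_on \<kappa> (insert {u, v} E) \<longleftrightarrow> \<kappa> u \<noteq> \<kappa> v \<and> proper_on \<kappa> E"
  unfolding proper_on_def by (metis doubleton_eq_iff insert_iff)

lemma proper_on_Collect: "proper_on \<kappa> {{f i, g i} | i. P i} \<longleftrightarrow> (\<forall>i. P i \<longrightarrow> \<kappa> (f i) \<noteq> \<kappa> (g i))"
  unfolding proper_on_def mem_Collect_eq by (metis doubleton_eq_iff)

text \<open>The order p_l, ..., p_1, c_2, ..., c_m, c_1 is a Hamiltonian path. The edges off it, c_1
  c_2 (for m > 2) and c_1 p_1, join the last vertex to positions \<open>l\<close> and
  \<open>l - 1\<close>.\<close>

lemma line_graph_tadpole_words:
  assumes "1 \<le> l" "l + 2 \<le> n" "m = n - l"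
  shows "chromatic_sym (line_graph (tadpole m l)) =
    monomial_sum mset {w \<in> tadpole_words n l. last w \<noteq> w ! (l - 1)}"
proof -
  define us :: "(nat + nat) list" where "us = map Inr (rev [1..<Suc l])"
  define vs :: "(nat + nat) list" where "vs = map Inl ([2..<Suc m] @ [1])"
  let ?G = "line_graph (tadpole m l)"
  have m: "2 \<le> m" using assms by simp
  have V: "fst ?G = set (us @ vs)" and dist: "distinct (us @ vs)"
    using m unfolding line_graph_tadpole[OF m assms(1)] us_def vs_def
    by (auto simp: distinct_map)
  have len: "length us = l" "length vs = m" "length (us @ vs) = n"
    using assms by (auto simp: us_def vs_def)
  have ne: "us \<noteq> []" "vs \<noteq> []" "last us = Inr 1" "hd vs = Inl 2" "last vs = Inl 1"
    using assms m by (auto simp: us_def vs_def last_map last_rev hd_map upt_rec)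
  have mset: "mset_set (fst ?G) = mset (us @ vs)"
    unfolding V using dist by (rule mset_set_set)
  have adj_us: "distinct_adj (map \<kappa> us) \<longleftrightarrow> (\<forall>j. 1 \<le> j \<and> j < l \<longrightarrow> \<kappa> (Inr j) \<noteq> \<kappa> (Inr (j + 1)))"
    for \<kappa> :: "nat + nat \<Rightarrow> nat"
  proof -
    have "map \<kappa> us = rev (map (\<lambda>j. \<kappa> (Inr j)) [1..<Suc l])"
      by (simp only: us_def rev_map map_map comp_def)
    then show ?thesis
      by (simp only: distinct_adj_rev distinct_adj_map_upt) auto
  qed
  have adj_vs: "distinct_adj (map \<kappa> vs) \<longleftrightarrow>
      (\<forall>i. 2 \<le> i \<and> i < m \<longrightarrow> \<kappa> (Inl i) \<noteq> \<kappa> (Inl (i + 1))) \<and> \<kappa> (Inl m) \<noteq> \<kappa> (Inl 1)"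
    for \<kappa> :: "nat + nat \<Rightarrow> nat"
  proof -
    have "map \<kappa> vs = map (\<lambda>i. \<kappa> (Inl i)) [2..<Suc m] @ [\<kappa> (Inl 1)]"
      by (simp only: vs_def map_append map_map comp_def list.map)
    moreover have "[2..<Suc m] \<noteq> []" "last [2..<Suc m] = m"
      using m by simp_all
    moreover from this have "distinct_adj (map (\<lambda>i. \<kappa> (Inl i)) [2..<Suc m] @ [\<kappa> (Inl 1)]) \<longleftrightarrow>
        distinct_adj (map (\<lambda>i. \<kappa> (Inl i)) [2..<Suc m]) \<and> \<kappa> (Inl m) \<noteq> \<kappa> (Inl 1)"
      by (simp only: distinct_adj_append_iff map_is_Nil_conv last_map list.sel list.distinct
          distinct_adj_singleton simp_thms)
    ultimately show ?thesis
      by (simp only: distinct_adj_map_upt) auto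
  qed
  have nth: "map \<kappa> (us @ vs) ! l = \<kappa> (Inl 2)" "map \<kappa> (us @ vs) ! (l - 1) = \<kappa> (Inr 1)"
    "last (map \<kappa> (us @ vs)) = \<kappa> (Inl 1)" for \<kappa> :: "nat + nat \<Rightarrow> nat"
  proof -
    show "map \<kappa> (us @ vs) ! l = \<kappa> (Inl 2)" "map \<kappa> (us @ vs) ! (l - 1) = \<kappa> (Inr 1)"
      using ne(1-4) len assms by (simp_all add: nth_append hd_conv_nth last_conv_nth)
    show "last (map \<kappa> (us @ vs)) = \<kappa> (Inl 1)"
      using ne by (simp add: last_map)
  qed
  have adj: "map \<kappa> (us @ vs) \<in> {w \<in> tadpole_words n l. last w \<noteq> w ! (l - 1)} \<longleftrightarrow>
      \<kappa> ` fst ?G \<subseteq> {1..} \<and> proper_on \<kappa> (snd ?G)" for \<kappa> :: "nat + nat \<Rightarrow> nat"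
  proof -
    have "map \<kappa> (us @ vs) \<in> {w \<in> tadpole_words n l. last w \<noteq> w ! (l - 1)} \<longleftrightarrow>
        \<kappa> ` fst ?G \<subseteq> {1..} \<and> distinct_adj (map \<kappa> (us @ vs)) \<and>
        \<kappa> (Inl 1) \<noteq> \<kappa> (Inl 2) \<and> \<kappa> (Inl 1) \<noteq> \<kappa> (Inr 1)"
      using len(3) by (simp only: tadpole_words_def carlitz_def mem_Collect_eq nth V set_map length_map) auto
    also have "distinct_adj (map \<kappa> (us @ vs)) \<longleftrightarrow>
        distinct_adj (map \<kappa> us) \<and> distinct_adj (map \<kappa> vs) \<and> \<kappa> (Inr 1) \<noteq> \<kappa> (Inl 2)"
      using ne by (simp add: distinct_adj_append_nonempty last_map hd_map)
    also have "\<kappa> ` fst ?G \<subseteq> {1..} \<and>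
        (distinct_adj (map \<kappa> us) \<and> distinct_adj (map \<kappa> vs) \<and> \<kappa> (Inr 1) \<noteq> \<kappa> (Inl 2)) \<and>
        \<kappa> (Inl 1) \<noteq> \<kappa> (Inl 2) \<and> \<kappa> (Inl 1) \<noteq> \<kappa> (Inr 1) \<longleftrightarrow>
      \<kappa> ` fst ?G \<subseteq> {1..} \<and> proper_on \<kappa> (snd ?G)"
    proof -
      \<comment> \<open>The edge c_1 c_2 is separated from the cycle edges because it is tested by
        the last letter. For \<open>m = 2\<close> it also is the path edge from c_m to c_1, and the
        two conditions coincide.\<close>
      have "(\<forall>i. 1 \<le> i \<and> i < m \<longrightarrow> \<kappa> (Inl i) \<noteq> \<kappa> (Inl (i + 1))) \<longleftrightarrow>
          \<kappa> (Inl 1) \<noteq> \<kappa> (Inl 2) \<and> (\<forall>i. 2 \<le> i \<and> i < m \<longrightarrow> \<kappa> (Inl i) \<noteq> \<kappa> (Inl (i + 1)))"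
      proof -
        have "1 \<le> i \<longleftrightarrow> i = 1 \<or> 2 \<le> i" for i :: nat by auto
        moreover have "1 < m" "(1 :: nat) + 1 = 2" using m by simp_all
        ultimately show ?thesis by metis
      qed
      then have "proper_on \<kappa> (snd ?G) \<longleftrightarrow>
          (\<kappa> (Inl 1) \<noteq> \<kappa> (Inl 2) \<and> (\<forall>i. 2 \<le> i \<and> i < m \<longrightarrow> \<kappa> (Inl i) \<noteq> \<kappa> (Inl (i + 1)))) \<and>
          \<kappa> (Inl m) \<noteq> \<kappa> (Inl 1) \<and> (\<forall>j. 1 \<le> j \<and> j < l \<longrightarrow> \<kappa> (Inr j) \<noteq> \<kappa> (Inr (j + 1))) \<and>
          \<kappa> (Inl 1) \<noteq> \<kappa> (Inr 1) \<and> \<kappa> (Inl 2) \<noteq> \<kappa> (Inr 1)"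
        unfolding line_graph_tadpole[OF m assms(1)] snd_conv proper_on_Un proper_on_Collect
          proper_on_insert proper_on_empty
        by (simp only: conj_assoc simp_thms)
      then show ?thesis
        unfolding adj_us adj_vs by (metis (no_types))
    qed
    finally show ?thesis .
  qed
  have image: "(\<lambda>\<kappa>. map \<kappa> (us @ vs)) ` proper_colorings ?G =
      {w \<in> tadpole_words n l. last w \<noteq> w ! (l - 1)}" (is "?F ` _ = ?W")
  proof (intro equalityI subsetI)
    fix w assume "w \<in> ?F ` proper_colorings ?G"
    then obtain \<kappa> where "w = ?F \<kappa>" "\<kappa> ` fst ?G \<subseteq> {1..}" "proper_on \<kappa> (snd ?G)"
      by (auto simp: proper_colorings_def proper_on_def)
    then show "w \<in> ?W" using adj by blast
  next
    fix w assume w: "w \<in> ?W"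
    \<comment> \<open>Each vertex gets the letter at its position; \<open>restrict\<close> makes the
      coloring extensional.\<close>
    define \<kappa> where "\<kappa> = restrict (\<lambda>v. the (map_of (zip (us @ vs) w) v)) (fst ?G)"
    have "length (us @ vs) = length w"
      using w len(3) by (simp add: tadpole_words_def carlitz_def)
    then have "?F \<kappa> = w"
      using dist by (intro nth_equalityI) (auto simp: \<kappa>_def V map_of_zip_nth simp del: set_append map_append)
    moreover have "\<kappa> \<in> extensional (fst ?G)"
      by (simp add: \<kappa>_def)
    ultimately have "\<kappa> \<in> proper_colorings ?G"
      using w adj[of \<kappa>] by (auto simp: proper_colorings_def proper_on_def PiE_def)
    then show "w \<in> ?F ` proper_colorings ?G"
      using \<open>?F \<kappa> = w\<close> by blast
  qed
  have inj: "inj_on ?F (proper_colorings ?G)"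
  proof (rule inj_onI)
    fix \<kappa> \<kappa>' assume "\<kappa> \<in> proper_colorings ?G" "\<kappa>' \<in> proper_colorings ?G" "?F \<kappa> = ?F \<kappa>'"
    then have "\<kappa> \<in> extensional (fst ?G)" "\<kappa>' \<in> extensional (fst ?G)" "\<forall>v\<in>fst ?G. \<kappa> v = \<kappa>' v"
      unfolding V map_eq_conv by (auto simp: proper_colorings_def V PiE_def)
    then show "\<kappa> = \<kappa>'" by (intro extensionalityI) auto
  qed
  show ?thesis
    unfolding chromatic_sym_def image[symmetric] mset
    by (simp only: monomial_sum_image[OF inj] mset_map)
qed

theorem theorem3p5:
  fixes l m n :: nat
  assumes "1 \<le> l" and "l + 2 \<le> n" and "m = n - l"
  shows "(chromatic_sym (line_graph (tadpole m l)) :: int mfps) =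
    (\<Sum>I \<in> {I \<in> compositions n. Theta_plus I l = 0}.
        of_int ((Theta_plus I (l + 1) - 1) * comp_weight I) * elem_sym_list I) +
    2 * (\<Sum>I \<in> {I \<in> compositions n. Theta_plus I l \<ge> 2}.
        of_int (Theta_plus I (l + 1) * comp_weight I) * elem_sym_list I)"
proof -
  let ?E = "\<lambda>j. {w \<in> carlitz n. last w = w ! j}"
  let ?f = "\<lambda>I. of_int ((Theta_plus I (l + 1) + Theta_plus I l - 1) * comp_weight I) * elem_sym_list I :: int mfps"
  \<comment> \<open>The forbidden letters are neighbours, so a word whose last letter repeats
    position \<open>l - 1\<close> automatically avoids the letter at \<open>l\<close>.\<close>
  have disj: "w ! (l - 1) \<noteq> w ! l" if "w \<in> carlitz n" for w
    using that assms distinct_adj_nth[of w "l - 1"] by (auto simp: carlitz_def)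
  have "{w \<in> tadpole_words n l. last w = w ! (l - 1)} = ?E (l - 1)"
    using disj by (fastforce simp: tadpole_words_def)
  then have "tadpole_sym n l = monomial_sum mset (?E (l - 1)) +
      monomial_sum mset {w \<in> tadpole_words n l. last w \<noteq> w ! (l - 1)}"
    by (subst monomial_sum_split[OF finite_fibres_mset, where P = "\<lambda>w. last w = w ! (l - 1)"])
      (simp only:)
  then have "chromatic_sym (line_graph (tadpole m l)) =
      tadpole_sym n l - monomial_sum mset (?E (l - 1))"
    by (simp add: line_graph_tadpole_words[OF assms])
  also have "\<dots> = tadpole_sym n l + tadpole_sym n (l - 1) - path_sym n"
    by (simp flip: path_sym_minus_tadpole_sym)
  also have "\<dots> = tadpole_exp n l + tadpole_exp n (l - 1) - path_exp n"
    using assms by (simp add: tadpole_sym_eq_tadpole_exp path_sym_eq_path_exp)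
  also have "\<dots> = (\<Sum>I\<in>compositions n. ?f I)"
    using assms unfolding tadpole_exp_def path_exp_def
    by (simp add: sum.distrib[symmetric] sum_subtractf[symmetric] algebra_simps)
  also have "\<dots> = (\<Sum>I \<in> {I \<in> compositions n. Theta_plus I l = 0}. ?f I) +
      (\<Sum>I \<in> compositions n - {I \<in> compositions n. Theta_plus I l = 0}. ?f I)"
    by (subst add.commute, rule sum.subset_diff) (auto simp: finite_compositions)
  \<comment> \<open>If \<open>Theta_plus I l = 1\<close>, then the value at \<open>l + 1\<close> is
    0 and the coefficient is 0 + 1 - 1 = 0.\<close>
  also have "(\<Sum>I \<in> compositions n - {I \<in> compositions n. Theta_plus I l = 0}. ?f I) =
      (\<Sum>I \<in> {I \<in> compositions n. Theta_plus I l \<ge> 2}. ?f I)"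
  proof (rule sum.mono_neutral_right)
    show "\<forall>I \<in> compositions n - {I \<in> compositions n. Theta_plus I l = 0} -
        {I \<in> compositions n. Theta_plus I l \<ge> 2}. ?f I = 0"
    proof
      fix I assume I: "I \<in> compositions n - {I \<in> compositions n. Theta_plus I l = 0} -
        {I \<in> compositions n. Theta_plus I l \<ge> 2}"
      then have s: "l \<le> sum_list I" using assms by (auto simp: compositions_def)
      with I have "Theta_plus I l = 1" using Theta_plus_nonneg[OF s] by auto
      then show "?f I = 0" using Theta_plus_Suc[OF s] by simp
    qed
  qed (auto simp: finite_compositions)
  \<comment> \<open>Here \<open>Theta_plus I l - 1\<close> equals
    \<open>Theta_plus I (l + 1)\<close>, which is where the factor 2 comes from.\<close>
  also have "\<dots> = (\<Sum>I \<in> {I \<in> compositions n. Theta_plus I l \<ge> 2}.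
      2 * (of_int (Theta_plus I (l + 1) * comp_weight I) * elem_sym_list I))"
  proof (rule sum.cong)
    fix I assume I: "I \<in> {I \<in> compositions n. Theta_plus I l \<ge> 2}"
    then have "Theta_plus I (l + 1) = Theta_plus I l - 1"
      using assms by (intro Theta_plus_Suc) (auto simp: compositions_def)
    then have "(Theta_plus I (l + 1) + Theta_plus I l - 1) * comp_weight I =
        2 * (Theta_plus I (l + 1) * comp_weight I)"
      by simp
    then show "?f I = 2 * (of_int (Theta_plus I (l + 1) * comp_weight I) * elem_sym_list I)"
      by (simp only: of_int_mult of_int_numeral mult.assoc)
  qed simp
  also have "(\<Sum>I \<in> {I \<in> compositions n. Theta_plus I l = 0}. ?f I) =
      (\<Sum>I \<in> {I \<in> compositions n. Theta_plus I l = 0}.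
        of_int ((Theta_plus I (l + 1) - 1) * comp_weight I) * elem_sym_list I)"
    by (rule sum.cong) auto
  finally show ?thesis
    by (simp only: sum_distrib_left)
qed

end
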